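(* Let $G$ be a topological group, let $K$ be a linearly ordered compact $G$-system whose action is effective, and let $\leq_G$ be a linear order on $G$ such that for every $x\in K$ the orbit map $\tilde{x}\colon G\to K$, $g\mapsto gx$, is linear order preserving. Then the Ellis semigroup $E(K)$ is a linearly ordered compact right topological semigroup and the Ellis compactification $j\colon G\to E(K)$ is a linearly ordered semigroup compactification of $(G,\leq_G)$.
   Context: The interval topology of a linearly ordered set $(X,\leq)$ has as subbase all rays $\{x: a<x\}$, $\{x: x<b\}$. A linearly ordered compact $G$-system is a linearly ordered set $(K,\leq)$ whose interval topology is compact, with a continuous action $G\times K\to K$ of the topological group $G$ such that every translation $x\mapsto gx$ preserves $\leq$. The action is effective if the only group element acting as the identity map is $e$. A map $f$ between linearly ordered sets is linear order preserving if $a\leq b$ implies $f(a)\leq f(b)$. The Ellis (enveloping) semigroup $E(K)$ is the closure in $K^K$ (product topology) of the set of all translations $\tilde g\colon K\to K$, $x\mapsto gx$ ($g\in G$), with composition as multiplication; the Ellis compactification is $j\colon G\to E(K)$, $g\mapsto\tilde g$. A compact right topological semigroup is a semigroup $S$ with a compact Hausdorff topology for which each right translation $x\mapsto xs$ is continuous. It is a linearly ordered compact right topological semigroup if there is a linear order on $S$ which is bi-invariant ($x\le y$ implies $sx\le sy$ and $xs\le ys$ for all $s$) and whose interval topology is the given topology. A right topological semigroup compactification of a topological group $G$ is a continuous homomorphism $\gamma\colon G\to S$ into a compact right topological semigroup with dense image such that the action $G\times S\to S$, $(g,s)\mapsto\gamma(g)s$, is continuous. A linearly ordered semigroup compactification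 of a topological group $G$ endowed with a bi-invariant linear order is a right topological semigroup compactification $\gamma\colon G\to S$ such that $S$ is a linearly ordered compact right topological semigroup (with a given such order) and $\gamma$ is linear order preserving. (The topology of $G$ need not be the interval topology of its order.) *)

theory Defs
  imports "HOL-Analysis.Analysis" "HOL-Algebra.Group_Action"
begin

text \<open>
  The set \<open>X\<close> itself is added to the subbase because \<open>topology_generated_by\<close> does not supply the
  empty intersection; this only matters when \<open>X\<close> is a singleton.
\<close>

definition interval_topology :: "'a set \<Rightarrow> 'a rel \<Rightarrow> 'a topology" where
  "interval_topology X r = topology_generated_by
     (insert X
       ({{x \<in> X. (a, x) \<in> r \<and> x \<noteq> a} | a. a \<in> X} \<union>
        {{x \<in> X. (x, b) \<in> r \<and> x \<noteq> b} | b. b \<in> X}))"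

lemma topspace_interval_topology [simp]: "topspace (interval_topology X r) = X"
  by (auto simp: interval_topology_def)

lemma interval_topology_UNIV:
  "interval_topology UNIV {(x, y). x \<le> y} = (euclidean :: 'a::linorder_topology topology)"
proof -
  let ?B = "range (\<lambda>a::'a. {..<a}) \<union> range (\<lambda>a. {a<..})"
  have "{x. a \<le> x \<and> x \<noteq> a} = {a<..}" and "{x. x \<le> a \<and> x \<noteq> a} = {..<a}" for a :: 'a
    by auto
  then have eq: "interval_topology UNIV {(x, y). x \<le> y} = topology_generated_by (insert UNIV ?B)"
    by (simp add: interval_topology_def full_SetCompr_eq Un_commute)
  have "generate_topology_on (insert UNIV ?B) S \<longleftrightarrow> generate_topology ?B S" for S
  proof
    show "generate_topology ?B S" if "generate_topology_on (insert UNIV ?B) S"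
      using that
    proof induction
      case Empty
      show ?case using generate_topology.UN[of "{}" ?B] by simp
    qed (auto intro: generate_topology.intros)
    show "generate_topology_on (insert UNIV ?B) S" if "generate_topology ?B S"
      using that by induction (auto intro: generate_topology_on.intros)
  qed
  then show ?thesis
    unfolding eq topology_eq openin_topology_generated_by_iff open_openin[symmetric]
    by (simp add: open_generated_order)
qed

abbreviation linear_order_preserving ::
    "'a set \<Rightarrow> 'a rel \<Rightarrow> 'b rel \<Rightarrow> ('a \<Rightarrow> 'b) \<Rightarrow> bool" where
  "linear_order_preserving A r s f \<equiv>
     monotone_on A (\<lambda>x y. (x, y) \<in> r) (\<lambda>x y. (x, y) \<in> s) f"

locale topological_group = group G for G (structure) +
  fixes T
  assumes topspace_eq_carrier: "topspace T = carrier G"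
    and continuous_mult: "continuous_map (prod_topology T T) T (\<lambda>(x, y). x \<otimes> y)"
    and continuous_inv: "continuous_map T T (\<lambda>x. inv x)"

locale linearly_ordered_compact_system =
  topological_group G TG + group_action G K \<phi>
  for G (structure) and TG and K :: "'k set" and r :: "'k rel" and \<phi> +
  assumes linear_order: "linear_order_on K r"
    and compact_space: "compact_space (interval_topology K r)"
    and continuous_action:
      "continuous_map (prod_topology TG (interval_topology K r)) (interval_topology K r)
         (\<lambda>(g, x). \<phi> g x)"
    and translation_preserving:
      "\<And>g. g \<in> carrier G \<Longrightarrow> linear_order_preserving K r r (\<phi> g)"

definition effective_action ::
    "('g, 'm) monoid_scheme \<Rightarrow> 'k set \<Rightarrow> ('g \<Rightarrow> 'k \<Rightarrow> 'k) \<Rightarrow> bool" where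
  "effective_action G K \<phi> \<longleftrightarrow>
     (\<forall>g \<in> carrier G. (\<forall>x \<in> K. \<phi> g x = x) \<longrightarrow> g = \<one>\<^bsub>G\<^esub>)"

text \<open>
  Semigroups with carrier are given by a \<open>monoid\<close> record whose field \<open>one\<close> is ignored.
\<close>

locale compact_right_topological_semigroup =
  fixes S (structure) and T
  assumes mult_closed: "\<And>x y. x \<in> carrier S \<Longrightarrow> y \<in> carrier S \<Longrightarrow> x \<otimes> y \<in> carrier S"
    and mult_assoc: "\<And>x y z. x \<in> carrier S \<Longrightarrow> y \<in> carrier S \<Longrightarrow> z \<in> carrier S \<Longrightarrow>
      (x \<otimes> y) \<otimes> z = x \<otimes> (y \<otimes> z)"
    and topspace_eq_carrier: "topspace T = carrier S"
    and compact_space: "compact_space T"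
    and Hausdorff_space: "Hausdorff_space T"
    and continuous_right_mult: "\<And>s. s \<in> carrier S \<Longrightarrow> continuous_map T T (\<lambda>x. x \<otimes> s)"

definition bi_invariant :: "('s, 'm) monoid_scheme \<Rightarrow> 's rel \<Rightarrow> bool" where
  "bi_invariant S r \<longleftrightarrow>
     (\<forall>s \<in> carrier S. \<forall>x \<in> carrier S. \<forall>y \<in> carrier S. (x, y) \<in> r \<longrightarrow>
        (s \<otimes>\<^bsub>S\<^esub> x, s \<otimes>\<^bsub>S\<^esub> y) \<in> r \<and> (x \<otimes>\<^bsub>S\<^esub> s, y \<otimes>\<^bsub>S\<^esub> s) \<in> r)"

locale linearly_ordered_compact_right_topological_semigroup =
  compact_right_topological_semigroup S T for S (structure) and T +
  fixes r
  assumes linear_order: "linear_order_on (carrier S) r"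
    and bi_invariant: "bi_invariant S r"
    and interval_topology: "T = interval_topology (carrier S) r"

locale right_topological_semigroup_compactification =
  G: topological_group G TG + S: compact_right_topological_semigroup S TS
  for G and TG and S and TS +
  fixes \<gamma>
  assumes hom: "\<gamma> \<in> hom G S"
    and continuous: "continuous_map TG TS \<gamma>"
    and dense: "TS closure_of (\<gamma> ` carrier G) = carrier S"
    and continuous_action:
      "continuous_map (prod_topology TG TS) TS (\<lambda>(g, s). \<gamma> g \<otimes>\<^bsub>S\<^esub> s)"

locale linearly_ordered_semigroup_compactification =
  right_topological_semigroup_compactification G TG S TS \<gamma> +
  linearly_ordered_compact_right_topological_semigroup S TS rS
  for G and TG and rG and S and TS and rS and \<gamma> +
  assumes linear_order_G: "linear_order_on (carrier G) rG"
    and bi_invariant_G: "bi_invariant G rG"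
    and preserving: "linear_order_preserving (carrier G) rG rS \<gamma>"

text \<open>
  Self-maps of the space are represented by functions that are extensional on its carrier, as in
  \<^const>\<open>BijGroup\<close> and \<^const>\<open>product_topology\<close>.
\<close>

definition ellis_compactification ::
    "'k topology \<Rightarrow> ('g \<Rightarrow> 'k \<Rightarrow> 'k) \<Rightarrow> 'g \<Rightarrow> 'k \<Rightarrow> 'k" where
  "ellis_compactification T \<phi> g = (\<lambda>x \<in> topspace T. \<phi> g x)"

definition ellis_semigroup ::
    "('g, 'm) monoid_scheme \<Rightarrow> 'k topology \<Rightarrow> ('g \<Rightarrow> 'k \<Rightarrow> 'k) \<Rightarrow> ('k \<Rightarrow> 'k) monoid" where
  "ellis_semigroup G T \<phi> =
     \<lparr>carrier = product_topology (\<lambda>_. T) (topspace T) closure_of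
        (ellis_compactification T \<phi> ` carrier G),
      mult = compose (topspace T),
      one = (\<lambda>x \<in> topspace T. x)\<rparr>"

definition ellis_topology ::
    "('g, 'm) monoid_scheme \<Rightarrow> 'k topology \<Rightarrow> ('g \<Rightarrow> 'k \<Rightarrow> 'k) \<Rightarrow> ('k \<Rightarrow> 'k) topology" where
  "ellis_topology G T \<phi> =
     subtopology (product_topology (\<lambda>_. T) (topspace T)) (carrier (ellis_semigroup G T \<phi>))"

end

theory Submission
  imports Defs
begin

text \<open>
  Order \<open>E(K)\<close> pointwise. The orbit maps preserve order, so the translations form a chain in the
  pointwise order; since the order of \<open>K\<close> is closed in \<open>K \<times> K\<close>, the closure \<open>E(K)\<close> is a chain of
  order preserving maps. Rays of this chain are pointwise open, so the interval topology is a
  Hausdorff topology coarser than the compact pointwise topology, and the two coincide.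
\<close>

section \<open>Interval topologies\<close>

lemma linear_order_onD:
  assumes "linear_order_on X r"
  shows linear_order_on_subset: "(x, y) \<in> r \<Longrightarrow> x \<in> X \<and> y \<in> X"
    and linear_order_on_refl: "x \<in> X \<Longrightarrow> (x, x) \<in> r"
    and linear_order_on_trans: "(x, y) \<in> r \<Longrightarrow> (y, z) \<in> r \<Longrightarrow> (x, z) \<in> r"
    and linear_order_on_antisym: "(x, y) \<in> r \<Longrightarrow> (y, x) \<in> r \<Longrightarrow> x = y"
    and linear_order_on_total: "x \<in> X \<Longrightarrow> y \<in> X \<Longrightarrow> (x, y) \<in> r \<or> (y, x) \<in> r"
proof -
  have "r \<subseteq> X \<times> X" "refl_on X r" "trans r" "antisym r" "total_on X r"
    using assms by (simp_all add: order_on_defs)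
  then show "(x, y) \<in> r \<Longrightarrow> x \<in> X \<and> y \<in> X" "x \<in> X \<Longrightarrow> (x, x) \<in> r"
    "(x, y) \<in> r \<Longrightarrow> (y, z) \<in> r \<Longrightarrow> (x, z) \<in> r" "(x, y) \<in> r \<Longrightarrow> (y, x) \<in> r \<Longrightarrow> x = y"
    "x \<in> X \<Longrightarrow> y \<in> X \<Longrightarrow> (x, y) \<in> r \<or> (y, x) \<in> r"
    by (blast, metis refl_onD, metis transD, metis antisymD, metis refl_onD total_on_def)
qed

lemma openin_upper_ray:
  "a \<in> X \<Longrightarrow> openin (interval_topology X r) {x \<in> X. (a, x) \<in> r \<and> x \<noteq> a}"
  unfolding interval_topology_def by (rule topology_generated_by_Basis) blast

lemma openin_lower_ray:
  "b \<in> X \<Longrightarrow> openin (interval_topology X r) {x \<in> X. (x, b) \<in> r \<and> x \<noteq> b}"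
  unfolding interval_topology_def by (rule topology_generated_by_Basis) blast

text \<open>If some \<open>c\<close> lies strictly between \<open>a\<close> and \<open>b\<close>,
  the rays below and above \<open>c\<close> work; otherwise \<open>a\<close> and \<open>b\<close>
  form a jump, and the ray below \<open>b\<close> and the ray above \<open>a\<close> work.
  Elementwise order between the neighbourhoods is more than disjointness: it yields the Hausdorff
  property and also openness of the strict order.\<close>

lemma interval_topology_separation:
  assumes r: "linear_order_on X r" and ab: "(a, b) \<in> r" "a \<noteq> b"
  obtains U V where "openin (interval_topology X r) U" "openin (interval_topology X r) V"
    "a \<in> U" "b \<in> V" "\<And>u v. u \<in> U \<Longrightarrow> v \<in> V \<Longrightarrow> (u, v) \<in> r \<and> u \<noteq> v"
proof (cases "\<exists>c. (a, c) \<in> r \<and> a \<noteq> c \<and> (c, b) \<in> r \<and> c \<noteq> b")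
  case True
  then obtain c where c: "(a, c) \<in> r" "a \<noteq> c" "(c, b) \<in> r" "c \<noteq> b" by blast
  then have X: "a \<in> X" "b \<in> X" "c \<in> X" using linear_order_on_subset[OF r] by blast+
  show ?thesis
  proof (rule that[of "{x \<in> X. (x, c) \<in> r \<and> x \<noteq> c}" "{x \<in> X. (c, x) \<in> r \<and> x \<noteq> c}"])
    show "(u, v) \<in> r \<and> u \<noteq> v"
      if "u \<in> {x \<in> X. (x, c) \<in> r \<and> x \<noteq> c}" "v \<in> {x \<in> X. (c, x) \<in> r \<and> x \<noteq> c}" for u v
      using that linear_order_on_trans[OF r, of u c v] linear_order_on_antisym[OF r, of u c] by blast
  qed (use c X in \<open>simp_all add: openin_lower_ray openin_upper_ray\<close>)
next
  case False
  have X: "a \<in> X" "b \<in> X" using ab(1) linear_order_on_subset[OF r] by blast+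
  show ?thesis
  proof (rule that[of "{x \<in> X. (x, b) \<in> r \<and> x \<noteq> b}" "{x \<in> X. (a, x) \<in> r \<and> x \<noteq> a}"])
    show "(u, v) \<in> r \<and> u \<noteq> v"
      if u: "u \<in> {x \<in> X. (x, b) \<in> r \<and> x \<noteq> b}" and v: "v \<in> {x \<in> X. (a, x) \<in> r \<and> x \<noteq> a}" for u v
    proof (rule ccontr)
      assume "\<not> ((u, v) \<in> r \<and> u \<noteq> v)"
      then have "(v, u) \<in> r" using linear_order_on_total[OF r, of u v] linear_order_on_refl[OF r] u v by blast
      then have "(a, u) \<in> r" using v linear_order_on_trans[OF r, of a v u] by blast
      moreover from \<open>(v, u) \<in> r\<close> have "a \<noteq> u"
        using v linear_order_on_antisym[OF r, of a v] by blast
      \<comment> \<open>Here \<open>u\<close> would lie strictly between \<open>a\<close> and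
        \<open>b\<close>, which the jump excludes.\<close>
      ultimately show False using False u by blast
    qed
  qed (use ab X in \<open>simp_all add: openin_lower_ray openin_upper_ray\<close>)
qed

lemma Hausdorff_interval_topology:
  assumes r: "linear_order_on X r"
  shows "Hausdorff_space (interval_topology X r)"
  unfolding Hausdorff_space_def
proof (intro allI impI)
  let ?T = "interval_topology X r"
  have sep: "\<exists>U V. openin ?T U \<and> openin ?T V \<and> x \<in> U \<and> y \<in> V \<and> disjnt U V"
    if xy: "(x, y) \<in> r" "x \<noteq> y" for x y
  proof -
    obtain U V where UV: "openin ?T U" "openin ?T V" "x \<in> U" "y \<in> V"
      and less: "\<And>u v. u \<in> U \<Longrightarrow> v \<in> V \<Longrightarrow> (u, v) \<in> r \<and> u \<noteq> v"
      by (rule interval_topology_separation[OF r xy]) (rule that)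
    have "disjnt U V" unfolding disjnt_iff using less by blast
    with UV show ?thesis by blast
  qed
  fix x y
  assume "x \<in> topspace ?T \<and> y \<in> topspace ?T \<and> x \<noteq> y"
  then have "x \<noteq> y" "(x, y) \<in> r \<or> (y, x) \<in> r"
    using linear_order_on_total[OF r, of x y] by auto
  then show "\<exists>U V. openin ?T U \<and> openin ?T V \<and> x \<in> U \<and> y \<in> V \<and> disjnt U V"
    using sep[of x y] sep[of y x] unfolding disjnt_iff by blast
qed

text \<open>Ordered neighbourhoods of \<open>f t\<close> and \<open>h t\<close> pull back along the
  two maps to a neighbourhood of \<open>t\<close> on which the strict inequality persists.\<close>

lemma openin_less:
  assumes r: "linear_order_on X r"
    and f: "continuous_map T (interval_topology X r) f"
    and h: "continuous_map T (interval_topology X r) h"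
  shows "openin T {t \<in> topspace T. (f t, h t) \<in> r \<and> f t \<noteq> h t}"
proof (subst openin_subopen, intro ballI)
  fix t assume t: "t \<in> {t \<in> topspace T. (f t, h t) \<in> r \<and> f t \<noteq> h t}"
  then have ft: "(f t, h t) \<in> r" "f t \<noteq> h t" by auto
  obtain U V where UV: "openin (interval_topology X r) U" "openin (interval_topology X r) V"
    "f t \<in> U" "h t \<in> V" and less: "\<And>u v. u \<in> U \<Longrightarrow> v \<in> V \<Longrightarrow> (u, v) \<in> r \<and> u \<noteq> v"
    by (rule interval_topology_separation[OF r ft]) (rule that)
  let ?W = "{t \<in> topspace T. f t \<in> U} \<inter> {t \<in> topspace T. h t \<in> V}"
  have "openin T ?W"
    by (rule openin_Int[OF openin_continuous_map_preimage[OF f UV(1)]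
          openin_continuous_map_preimage[OF h UV(2)]])
  moreover have "t \<in> ?W" using t UV(3,4) by blast
  moreover have "?W \<subseteq> {t \<in> topspace T. (f t, h t) \<in> r \<and> f t \<noteq> h t}" using less by blast
  ultimately show "\<exists>W. openin T W \<and> t \<in> W \<and> W \<subseteq> {t \<in> topspace T. (f t, h t) \<in> r \<and> f t \<noteq> h t}"
    by blast
qed

text \<open>By totality and antisymmetry, the complement is the open set where \<open>h t\<close> is
  strictly below \<open>f t\<close>. This is closedness of the order in the square, phrased for
  pairs of continuous maps so that it applies directly to projections and constants.\<close>

lemma closedin_le:
  assumes r: "linear_order_on X r"
    and f: "continuous_map T (interval_topology X r) f"
    and h: "continuous_map T (interval_topology X r) h"
  shows "closedin T {t \<in> topspace T. (f t, h t) \<in> r}"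
proof -
  have "(f t, h t) \<in> r \<longleftrightarrow> \<not> ((h t, f t) \<in> r \<and> h t \<noteq> f t)" if t: "t \<in> topspace T" for t
  proof -
    have "f t \<in> X" "h t \<in> X"
      using t continuous_map_funspace[OF f] continuous_map_funspace[OF h] by auto
    then show ?thesis
      using linear_order_on_total[OF r] linear_order_on_antisym[OF r] by metis
  qed
  then have "{t \<in> topspace T. (f t, h t) \<in> r} =
      topspace T - {t \<in> topspace T. (h t, f t) \<in> r \<and> h t \<noteq> f t}"
    by blast
  then show ?thesis
    using openin_less[OF r h f] by (simp add: closedin_diff)
qed

lemma continuous_map_into_interval_topology:
  assumes "f \<in> topspace T \<rightarrow> X"
    and "\<And>a. a \<in> X \<Longrightarrow> openin T {t \<in> topspace T. (a, f t) \<in> r \<and> f t \<noteq> a}"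
    and "\<And>b. b \<in> X \<Longrightarrow> openin T {t \<in> topspace T. (f t, b) \<in> r \<and> f t \<noteq> b}"
  shows "continuous_map T (interval_topology X r) f"
  unfolding interval_topology_def
proof (rule continuous_on_generated_topo)
  fix U
  assume "U \<in> insert X ({{x \<in> X. (a, x) \<in> r \<and> x \<noteq> a} | a. a \<in> X} \<union>
    {{x \<in> X. (x, b) \<in> r \<and> x \<noteq> b} | b. b \<in> X})"
  then consider "U = X"
    | a where "a \<in> X" "U = {x \<in> X. (a, x) \<in> r \<and> x \<noteq> a}"
    | b where "b \<in> X" "U = {x \<in> X. (x, b) \<in> r \<and> x \<noteq> b}"
    by blast
  then show "openin T (f -` U \<inter> topspace T)"
  proof cases
    case 1
    with assms(1) have "f -` U \<inter> topspace T = topspace T" by auto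
    then show ?thesis by simp
  next
    case 2
    with assms(1) have "f -` U \<inter> topspace T = {t \<in> topspace T. (a, f t) \<in> r \<and> f t \<noteq> a}"
      by auto
    with assms(2) 2 show ?thesis by simp
  next
    case 3
    with assms(1) have "f -` U \<inter> topspace T = {t \<in> topspace T. (f t, b) \<in> r \<and> f t \<noteq> b}"
      by auto
    with assms(3) 3 show ?thesis by simp
  qed
qed (use assms(1) in auto)

text \<open>A continuous map from a compact space to a Hausdorff space is closed, so the identity is
  a homeomorphism.\<close>

lemma compact_eq_Hausdorff_topology:
  assumes "compact_space T" "Hausdorff_space T'" "continuous_map T T' id"
    and "topspace T = topspace T'"
  shows "T = T'"
proof -
  have "closed_map T T' id"
    using assms(1-3) by (simp add: continuous_imp_closed_map)
  then have "homeomorphic_map T T' id"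
    using assms by (intro bijective_closed_imp_homeomorphic_map) auto
  then show ?thesis by simp
qed

section \<open>Chains of functions in the pointwise order\<close>

text \<open>Both arguments are confined to \<open>C\<close> because \<open>linear_order_on C\<close>
  demands a relation contained in the square of \<open>C\<close>.\<close>

definition pointwise_order :: "'i set \<Rightarrow> 'a rel \<Rightarrow> ('i \<Rightarrow> 'a) set \<Rightarrow> ('i \<Rightarrow> 'a) rel" where
  "pointwise_order I r C = {(p, q). p \<in> C \<and> q \<in> C \<and> (\<forall>i \<in> I. (p i, q i) \<in> r)}"

lemma closedin_pointwise_le:
  assumes r: "linear_order_on X r"
    and f: "\<And>i. i \<in> I \<Longrightarrow> continuous_map T (interval_topology X r) (f i)"
    and h: "\<And>i. i \<in> I \<Longrightarrow> continuous_map T (interval_topology X r) (h i)"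
  shows "closedin T {t \<in> topspace T. \<forall>i \<in> I. (f i t, h i t) \<in> r}"
proof -
  \<comment> \<open>Inserting \<open>topspace T\<close> keeps the family nonempty when
    \<open>I\<close> is empty and gives the right intersection in that case.\<close>
  let ?F = "insert (topspace T) ((\<lambda>i. {t \<in> topspace T. (f i t, h i t) \<in> r}) ` I)"
  have "closedin T (\<Inter> ?F)"
    using closedin_le[OF r f h] by (intro closedin_Inter) auto
  also have "\<Inter> ?F = {t \<in> topspace T. \<forall>i \<in> I. (f i t, h i t) \<in> r}" by auto
  finally show ?thesis .
qed

lemma closedin_pointwise_comparable:
  fixes r :: "'a rel"
  assumes r: "linear_order_on X r" and q: "q \<in> (\<Pi>\<^sub>E i \<in> I. X)"
  defines "P \<equiv> product_topology (\<lambda>_. interval_topology X r) I"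
  shows "closedin P {p \<in> topspace P. (\<forall>i \<in> I. (p i, q i) \<in> r) \<or> (\<forall>i \<in> I. (q i, p i) \<in> r)}"
proof -
  have proj: "continuous_map P (interval_topology X r) (\<lambda>p. p i)" if "i \<in> I" for i
    unfolding P_def using that by (rule continuous_map_product_projection)
  have const: "continuous_map P (interval_topology X r) (\<lambda>_. q i)" if "i \<in> I" for i
    using q that by auto
  have "closedin P ({p \<in> topspace P. \<forall>i \<in> I. (p i, q i) \<in> r} \<union>
      {p \<in> topspace P. \<forall>i \<in> I. (q i, p i) \<in> r})"
    using proj const by (intro closedin_Un closedin_pointwise_le[OF r])
  also have "\<dots> = {p \<in> topspace P. (\<forall>i \<in> I. (p i, q i) \<in> r) \<or> (\<forall>i \<in> I. (q i, p i) \<in> r)}"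
    by blast
  finally show ?thesis .
qed

text \<open>Comparability with one fixed function is a closed condition, so the closure is reached
  one argument at a time: first \<open>p\<close> moves from \<open>A\<close> to its closure while
  \<open>q\<close> stays in \<open>A\<close>, then \<open>p\<close> is fixed and \<open>q\<close>
  moves.\<close>

lemma pointwise_chain_closure:
  assumes r: "linear_order_on X r" and A: "A \<subseteq> (\<Pi>\<^sub>E i \<in> I. X)"
    and chain: "\<And>p q. p \<in> A \<Longrightarrow> q \<in> A \<Longrightarrow>
      (\<forall>i \<in> I. (p i, q i) \<in> r) \<or> (\<forall>i \<in> I. (q i, p i) \<in> r)"
    and p: "p \<in> product_topology (\<lambda>_. interval_topology X r) I closure_of A"
    and q: "q \<in> product_topology (\<lambda>_. interval_topology X r) I closure_of A"
  shows "(\<forall>i \<in> I. (p i, q i) \<in> r) \<or> (\<forall>i \<in> I. (q i, p i) \<in> r)"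
proof -
  let ?P = "product_topology (\<lambda>_. interval_topology X r) I"
  let ?S = "\<lambda>q. {p \<in> topspace ?P. (\<forall>i \<in> I. (p i, q i) \<in> r) \<or> (\<forall>i \<in> I. (q i, p i) \<in> r)}"
  have closed: "?P closure_of A \<subseteq> ?S q" if "A \<subseteq> ?S q" "q \<in> (\<Pi>\<^sub>E i \<in> I. X)" for q
    using that(1) closedin_pointwise_comparable[OF r that(2)] by (rule closure_of_minimal)
  have top: "topspace ?P = (\<Pi>\<^sub>E i \<in> I. X)" by simp
  have "A \<subseteq> ?S q" if "q \<in> A" for q
    using chain[OF _ that] A unfolding top by blast
  then have "p \<in> ?S q" if "q \<in> A" for q
    using closed[of q] p A that by blast
  \<comment> \<open>Comparability is symmetric, so the two arguments may exchange roles.\<close>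
  then have "A \<subseteq> ?S p" using A unfolding top by blast
  moreover have "p \<in> (\<Pi>\<^sub>E i \<in> I. X)" using p unfolding in_closure_of top by blast
  ultimately have "q \<in> ?S p" using closed[of p] q by blast
  then show ?thesis by blast
qed

lemma linear_order_on_pointwise_order:
  assumes r: "linear_order_on X r" and C: "C \<subseteq> (\<Pi>\<^sub>E i \<in> I. X)"
    and chain: "\<And>p q. p \<in> C \<Longrightarrow> q \<in> C \<Longrightarrow>
      (\<forall>i \<in> I. (p i, q i) \<in> r) \<or> (\<forall>i \<in> I. (q i, p i) \<in> r)"
  shows "linear_order_on C (pointwise_order I r C)"
  unfolding order_on_defs
proof (intro conjI)
  show "refl_on C (pointwise_order I r C)"
    using C linear_order_on_refl[OF r] by (fastforce simp: refl_on_def pointwise_order_def)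
  show "trans (pointwise_order I r C)"
    using linear_order_on_trans[OF r] by (fastforce simp: trans_def pointwise_order_def)
  show "antisym (pointwise_order I r C)"
  proof (rule antisymI)
    fix p q assume "(p, q) \<in> pointwise_order I r C" "(q, p) \<in> pointwise_order I r C"
    then have "p \<in> (\<Pi>\<^sub>E i \<in> I. X)" "q \<in> (\<Pi>\<^sub>E i \<in> I. X)" "\<And>i. i \<in> I \<Longrightarrow> p i = q i"
      using C linear_order_on_antisym[OF r] by (auto simp: pointwise_order_def)
    \<comment> \<open>Agreement on \<open>I\<close> suffices because both functions are
      extensional.\<close>
    then show "p = q" by (rule PiE_ext)
  qed
  show "total_on C (pointwise_order I r C)"
    using chain by (auto simp: total_on_def pointwise_order_def)
qed (auto simp: pointwise_order_def)

text \<open>The rays of the chain are open in the pointwise topology, so the identity is continuous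
  from the compact pointwise topology to the Hausdorff interval topology, and hence the two
  agree.\<close>

lemma pointwise_topology_eq_interval_topology:
  fixes r :: "'a rel"
  assumes r: "linear_order_on X r" and C: "C \<subseteq> (\<Pi>\<^sub>E i \<in> I. X)"
    and chain: "\<And>p q. p \<in> C \<Longrightarrow> q \<in> C \<Longrightarrow>
      (\<forall>i \<in> I. (p i, q i) \<in> r) \<or> (\<forall>i \<in> I. (q i, p i) \<in> r)"
  defines "T \<equiv> subtopology (product_topology (\<lambda>_. interval_topology X r) I) C"
  assumes compact: "compact_space T"
  shows "T = interval_topology C (pointwise_order I r C)"
proof -
  have top: "topspace T = C" using C by (auto simp: T_def)
  have proj: "continuous_map T (interval_topology X r) (\<lambda>p. p i)" if "i \<in> I" for i
    unfolding T_def using that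
    by (intro continuous_map_from_subtopology continuous_map_product_projection)
  have const: "continuous_map T (interval_topology X r) (\<lambda>_. q i)" if "q \<in> C" "i \<in> I" for q i
    using C that by auto
  let ?le = "pointwise_order I r C"
  have lin: "linear_order_on C ?le"
    using r C chain by (rule linear_order_on_pointwise_order)
  have le: "closedin T {p \<in> topspace T. (p, a) \<in> ?le}" "closedin T {p \<in> topspace T. (a, p) \<in> ?le}"
    if a: "a \<in> C" for a
    using closedin_pointwise_le[OF r proj const[OF a]]
      closedin_pointwise_le[OF r const[OF a] proj] a
    by (auto simp: pointwise_order_def top cong: conj_cong)
  \<comment> \<open>Strictness in the chain means only inequality of functions, not strictness at
    every coordinate. Totality turns a ray into the complement of a closed set given by weak
    inequalities.\<close>
  have ray: "{p \<in> topspace T. (a, p) \<in> ?le \<and> p \<noteq> a} = topspace T - {p \<in> topspace T. (p, a) \<in> ?le}"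
      "{p \<in> topspace T. (p, a) \<in> ?le \<and> p \<noteq> a} = topspace T - {p \<in> topspace T. (a, p) \<in> ?le}"
    if a: "a \<in> C" for a
    using linear_order_on_total[OF lin a] linear_order_on_antisym[OF lin, of a]
      linear_order_on_refl[OF lin a] by (auto simp: top)
  show ?thesis
  proof (rule compact_eq_Hausdorff_topology)
    show "continuous_map T (interval_topology C ?le) id"
    proof (rule continuous_map_into_interval_topology)
      fix a assume a: "a \<in> C"
      show "openin T {p \<in> topspace T. (a, id p) \<in> ?le \<and> id p \<noteq> a}"
        "openin T {p \<in> topspace T. (id p, a) \<in> ?le \<and> id p \<noteq> a}"
        unfolding id_apply ray[OF a] by (intro openin_diff openin_topspace le[OF a])+
    qed (simp add: top)
    show "Hausdorff_space (interval_topology C ?le)"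
      by (rule Hausdorff_interval_topology[OF lin])
  qed (use compact top in simp_all)
qed

section \<open>The Ellis semigroup of a linearly ordered system\<close>

context linearly_ordered_compact_system
begin

abbreviation pointwise_topology :: "('k \<Rightarrow> 'k) topology" where
  "pointwise_topology \<equiv> product_topology (\<lambda>_. interval_topology K r) K"

abbreviation ellis_map :: "'a \<Rightarrow> 'k \<Rightarrow> 'k" where
  "ellis_map \<equiv> ellis_compactification (interval_topology K r) \<phi>"

abbreviation ellis_set :: "('k \<Rightarrow> 'k) set" where
  "ellis_set \<equiv> carrier (ellis_semigroup G (interval_topology K r) \<phi>)"

abbreviation ellis_order :: "('k \<Rightarrow> 'k) rel" where
  "ellis_order \<equiv> pointwise_order K r ellis_set"

lemma carrier_ellis_semigroup:
  "ellis_set = pointwise_topology closure_of (ellis_map ` carrier G)"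
  by (simp add: ellis_semigroup_def)

lemma mult_ellis_semigroup:
  "p \<otimes>\<^bsub>ellis_semigroup G (interval_topology K r) \<phi>\<^esub> q = compose K p q"
  by (simp add: ellis_semigroup_def)

lemma ellis_topology_eq:
  "ellis_topology G (interval_topology K r) \<phi> = subtopology pointwise_topology ellis_set"
  by (simp add: ellis_topology_def)

lemma ellis_map_apply: "x \<in> K \<Longrightarrow> ellis_map g x = \<phi> g x"
  by (simp add: ellis_compactification_def)

lemma translation_closed: "g \<in> carrier G \<Longrightarrow> x \<in> K \<Longrightarrow> \<phi> g x \<in> K"
  using element_image by blast

lemma ellis_map_in_PiE: "g \<in> carrier G \<Longrightarrow> ellis_map g \<in> (\<Pi>\<^sub>E x \<in> K. K)"
  by (auto simp: ellis_compactification_def translation_closed)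

lemma ellis_set_subset: "ellis_set \<subseteq> (\<Pi>\<^sub>E x \<in> K. K)"
  using closure_of_subset_topspace[of pointwise_topology "ellis_map ` carrier G"]
  by (simp add: carrier_ellis_semigroup)

lemma ellis_set_closed: "p \<in> ellis_set \<Longrightarrow> x \<in> K \<Longrightarrow> p x \<in> K"
  using ellis_set_subset by blast

lemma ellis_map_in_ellis_set: "g \<in> carrier G \<Longrightarrow> ellis_map g \<in> ellis_set"
  unfolding carrier_ellis_semigroup
  by (rule subsetD[OF closure_of_subset]) (use ellis_map_in_PiE in auto)

lemma closedin_ellis_set: "closedin pointwise_topology ellis_set"
  by (simp add: carrier_ellis_semigroup)

lemma topspace_ellis_topology: "topspace (ellis_topology G (interval_topology K r) \<phi>) = ellis_set"
  using ellis_set_subset by (auto simp: ellis_topology_eq)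

text \<open>This serves as an induction principle: a closed property of all translations passes to
  every element of E(K).\<close>

lemma ellis_set_minimal:
  "closedin pointwise_topology S \<Longrightarrow> ellis_map ` carrier G \<subseteq> S \<Longrightarrow> ellis_set \<subseteq> S"
  unfolding carrier_ellis_semigroup by (rule closure_of_minimal)

lemma compact_space_ellis_topology:
  "compact_space (ellis_topology G (interval_topology K r) \<phi>)"
  unfolding ellis_topology_eq
  by (intro compact_space_subtopology closedin_compact_space closedin_ellis_set)
    (simp_all add: compact_space_product_topology compact_space)

lemma continuous_map_translation:
  assumes "g \<in> carrier G"
  shows "continuous_map (interval_topology K r) (interval_topology K r) (\<phi> g)"
proof -
  have "continuous_map (interval_topology K r) (prod_topology TG (interval_topology K r)) (\<lambda>x. (g, x))"
    using assms topspace_eq_carrier by (simp add: continuous_map_paired)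
  from continuous_map_compose[OF this continuous_action] show ?thesis
    by (simp add: o_def)
qed

lemma continuous_map_orbit:
  assumes "x \<in> K"
  shows "continuous_map TG (interval_topology K r) (\<lambda>g. \<phi> g x)"
proof -
  have "continuous_map TG (prod_topology TG (interval_topology K r)) (\<lambda>g. (g, x))"
    using assms by (simp add: continuous_map_paired)
  from continuous_map_compose[OF this continuous_action] show ?thesis
    by (simp add: o_def)
qed

lemma continuous_map_into_pointwise_topology:
  assumes "\<And>x. x \<in> K \<Longrightarrow> continuous_map T (interval_topology K r) (\<lambda>t. f t x)"
    and "\<And>t. t \<in> topspace T \<Longrightarrow> f t \<in> extensional K"
  shows "continuous_map T pointwise_topology f"
  using assms by (auto simp: continuous_map_componentwise)

lemma continuous_map_ellis_eval:
  "x \<in> K \<Longrightarrow> continuous_map (ellis_topology G (interval_topology K r) \<phi>) (interval_topology K r) (\<lambda>p. p x)"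
  unfolding ellis_topology_eq
  by (intro continuous_map_from_subtopology continuous_map_product_projection)

section \<open>Closure of E(K) under composition, and monotonicity of its elements\<close>

lemma ellis_map_mult:
  assumes "g \<in> carrier G" "h \<in> carrier G"
  shows "ellis_map (g \<otimes> h) = compose K (ellis_map g) (ellis_map h)"
  using assms by (auto simp: ellis_compactification_def compose_def composition_rule translation_closed
      intro!: restrict_ext)

text \<open>Left composition with a translation is continuous on the product and sends translations
  to translations, so it maps their closure into itself.\<close>

lemma compose_ellis_map_in_ellis_set:
  assumes g: "g \<in> carrier G" and p: "p \<in> ellis_set"
  shows "compose K (ellis_map g) p \<in> ellis_set"
proof -
  have cont: "continuous_map pointwise_topology pointwise_topology (compose K (ellis_map g))"
  proof (rule continuous_map_into_pointwise_topology)
    fix x assume x: "x \<in> K"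
    \<comment> \<open>At coordinate \<open>x\<close> the composite is \<open>\<phi> g\<close>
      applied to \<open>p x\<close>; continuity of the translation enters here.\<close>
    have "continuous_map pointwise_topology (interval_topology K r) (\<phi> g \<circ> (\<lambda>p. p x))"
      using x g by (intro continuous_map_compose[OF continuous_map_product_projection]
          continuous_map_translation)
    then show "continuous_map pointwise_topology (interval_topology K r)
        (\<lambda>p. compose K (ellis_map g) p x)"
      by (rule continuous_map_eq) (use x in \<open>auto simp: compose_eq ellis_map_apply PiE_iff\<close>)
  qed simp
  have "compose K (ellis_map g) ` (ellis_map ` carrier G) \<subseteq> ellis_map ` carrier G"
    using g by (auto simp flip: ellis_map_mult)
  then have "pointwise_topology closure_of (compose K (ellis_map g) ` (ellis_map ` carrier G)) \<subseteq> ellis_set"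
    unfolding carrier_ellis_semigroup by (rule closure_of_mono)
  with continuous_map_image_closure_subset[OF cont] p show ?thesis
    unfolding carrier_ellis_semigroup by blast
qed

text \<open>The coordinate at \<open>x\<close> of \<open>compose K p q\<close> is the coordinate of
  \<open>p\<close> at \<open>q x\<close>, hence a projection.\<close>

lemma continuous_map_compose_right:
  assumes "\<And>x. x \<in> K \<Longrightarrow> q x \<in> K"
  shows "continuous_map pointwise_topology pointwise_topology (\<lambda>p. compose K p q)"
proof (rule continuous_map_into_pointwise_topology)
  fix x assume x: "x \<in> K"
  have "continuous_map pointwise_topology (interval_topology K r) (\<lambda>p. p (q x))"
    using x assms by (intro continuous_map_product_projection)
  then show "continuous_map pointwise_topology (interval_topology K r) (\<lambda>p. compose K p q x)"
    using x by (simp add: compose_eq)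
qed simp

text \<open>For fixed \<open>q\<close>, the set of \<open>p\<close> with
  \<open>compose K p q\<close> in E(K) is closed, by continuity of right composition, and it
  contains all translations by the preceding case of a translation on the left.\<close>

lemma compose_in_ellis_set:
  assumes p: "p \<in> ellis_set" and q: "q \<in> ellis_set"
  shows "compose K p q \<in> ellis_set"
proof -
  have "closedin pointwise_topology {p \<in> topspace pointwise_topology. compose K p q \<in> ellis_set}"
    by (rule closedin_continuous_map_preimage[OF continuous_map_compose_right closedin_ellis_set])
      (rule ellis_set_closed[OF q])
  then have "ellis_set \<subseteq> {p \<in> topspace pointwise_topology. compose K p q \<in> ellis_set}"
    by (rule ellis_set_minimal) (use q ellis_map_in_PiE compose_ellis_map_in_ellis_set in auto)
  with p show ?thesis by blast
qed

text \<open>For fixed \<open>x\<close> and \<open>y\<close> the inequality between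
  \<open>p x\<close> and \<open>p y\<close> is closed in \<open>p\<close> and holds for
  translations. This supplies left invariance of the order of E(K).\<close>

lemma ellis_set_mono:
  assumes p: "p \<in> ellis_set" and xy: "(x, y) \<in> r"
  shows "(p x, p y) \<in> r"
proof -
  have K: "x \<in> K" "y \<in> K" using linear_order_on_subset[OF linear_order xy] by auto
  have "closedin pointwise_topology {p \<in> topspace pointwise_topology. (p x, p y) \<in> r}"
    using K by (intro closedin_le[OF linear_order] continuous_map_product_projection)
  then have "ellis_set \<subseteq> {p \<in> topspace pointwise_topology. (p x, p y) \<in> r}"
  proof (rule ellis_set_minimal)
    show "ellis_map ` carrier G \<subseteq> {p \<in> topspace pointwise_topology. (p x, p y) \<in> r}"
      using K xy ellis_map_in_PiE monotone_onD[OF translation_preserving]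
      by (auto simp: ellis_map_apply)
  qed
  with p show ?thesis by blast
qed

section \<open>The Ellis compactification without its order\<close>

lemma compact_right_topological_ellis_semigroup:
  "compact_right_topological_semigroup (ellis_semigroup G (interval_topology K r) \<phi>)
     (ellis_topology G (interval_topology K r) \<phi>)"
proof (unfold_locales, unfold mult_ellis_semigroup)
  let ?T = "ellis_topology G (interval_topology K r) \<phi>"
  show "compose K p q \<in> ellis_set" if "p \<in> ellis_set" "q \<in> ellis_set" for p q
    using that by (rule compose_in_ellis_set)
  show "compose K (compose K p q) s = compose K p (compose K q s)"
    if "p \<in> ellis_set" "q \<in> ellis_set" "s \<in> ellis_set" for p q s
    \<comment> \<open>\<open>compose\<close> restricts to \<open>K\<close>, so associativity relies
      on \<open>s\<close> mapping \<open>K\<close> into \<open>K\<close>.\<close>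
    using ellis_set_closed[OF that(3)] by (auto simp: compose_def intro!: restrict_ext)
  show "Hausdorff_space ?T"
    unfolding ellis_topology_eq
    by (intro Hausdorff_space_subtopology)
      (simp add: Hausdorff_space_product_topology Hausdorff_interval_topology[OF linear_order])
  show "continuous_map ?T ?T (\<lambda>p. compose K p q)" if q: "q \<in> ellis_set" for q
    unfolding ellis_topology_eq
    using q continuous_map_compose_right[OF ellis_set_closed[OF q]] compose_in_ellis_set
    by (intro continuous_map_into_subtopology continuous_map_from_subtopology) auto
qed (simp_all add: topspace_ellis_topology compact_space_ellis_topology)

lemma right_topological_semigroup_compactification_ellis_map:
  "right_topological_semigroup_compactification G TG (ellis_semigroup G (interval_topology K r) \<phi>)
     (ellis_topology G (interval_topology K r) \<phi>) ellis_map"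
proof -
  let ?T = "ellis_topology G (interval_topology K r) \<phi>"
  interpret S: compact_right_topological_semigroup
    "ellis_semigroup G (interval_topology K r) \<phi>" ?T
    by (rule compact_right_topological_ellis_semigroup)
  show ?thesis
  proof (unfold_locales, unfold mult_ellis_semigroup)
    show "ellis_map \<in> hom G (ellis_semigroup G (interval_topology K r) \<phi>)"
      by (auto simp: hom_def mult_ellis_semigroup ellis_map_mult ellis_map_in_ellis_set)
    show "continuous_map TG ?T ellis_map"
      unfolding ellis_topology_eq
    proof (intro continuous_map_into_subtopology continuous_map_into_pointwise_topology)
      show "ellis_map \<in> topspace TG \<rightarrow> ellis_set"
        using ellis_map_in_ellis_set topspace_eq_carrier by simp
    qed (simp_all add: ellis_map_apply continuous_map_orbit, simp add: ellis_compactification_def)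
    \<comment> \<open>The closure in the subspace is E(K) intersected with the closure in the full
      product of this trace, and the trace is the whole set of translations.\<close>
    have "ellis_set \<inter> ellis_map ` carrier G = ellis_map ` carrier G"
      using ellis_map_in_ellis_set by blast
    then show "?T closure_of (ellis_map ` carrier G) = ellis_set"
      unfolding ellis_topology_eq closure_of_subtopology by (simp flip: carrier_ellis_semigroup)
    have "continuous_map (prod_topology TG ?T) pointwise_topology
        (\<lambda>t. compose K (ellis_map (fst t)) (snd t))"
    proof (rule continuous_map_into_pointwise_topology)
      fix x assume x: "x \<in> K"
      \<comment> \<open>At coordinate \<open>x\<close> the action sends \<open>(g, p)\<close> to
        \<open>\<phi> g (p x)\<close>, so joint continuity follows from that of the action on
        \<open>K\<close>, preceded by evaluation at \<open>x\<close>.\<close>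
      have "continuous_map (prod_topology TG ?T) (prod_topology TG (interval_topology K r))
          (\<lambda>t. (fst t, snd t x))"
        using continuous_map_compose[OF continuous_map_snd continuous_map_ellis_eval[OF x], of TG]
        by (intro continuous_map_pairedI continuous_map_fst) (simp add: o_def)
      from continuous_map_compose[OF this continuous_action]
      show "continuous_map (prod_topology TG ?T) (interval_topology K r)
          (\<lambda>t. compose K (ellis_map (fst t)) (snd t) x)"
        by (rule continuous_map_eq)
          (use x ellis_set_closed in \<open>simp add: topspace_ellis_topology compose_eq ellis_map_apply
             mem_Times_iff\<close>)
    qed simp
    moreover have "compose K (ellis_map (fst t)) (snd t) \<in> ellis_set"
      if "t \<in> topspace (prod_topology TG ?T)" for t
      using that compose_ellis_map_in_ellis_set
      by (simp add: topspace_ellis_topology topspace_eq_carrier mem_Times_iff)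
    ultimately show "continuous_map (prod_topology TG ?T) ?T (\<lambda>(g, p). compose K (ellis_map g) p)"
      by (subst (2) ellis_topology_eq) (simp add: continuous_map_in_subtopology case_prod_unfold)
  qed
qed

section \<open>The linear order on E(K)\<close>

lemma ellis_maps_chain:
  assumes rG: "linear_order_on (carrier G) rG"
    and orbit: "\<And>x. x \<in> K \<Longrightarrow> linear_order_preserving (carrier G) rG r (\<lambda>g. \<phi> g x)"
    and p: "p \<in> ellis_map ` carrier G" and q: "q \<in> ellis_map ` carrier G"
  shows "(\<forall>x \<in> K. (p x, q x) \<in> r) \<or> (\<forall>x \<in> K. (q x, p x) \<in> r)"
proof -
  obtain g h where gh: "g \<in> carrier G" "h \<in> carrier G" "p = ellis_map g" "q = ellis_map h"
    using p q by blast
  have le: "(\<phi> a x, \<phi> b x) \<in> r"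
    if "(a, b) \<in> rG" "x \<in> K" "a \<in> carrier G" "b \<in> carrier G" for a b x
    using monotone_onD[OF orbit[OF that(2)] that(3,4,1)] .
  consider "(g, h) \<in> rG" | "(h, g) \<in> rG"
    using linear_order_on_total[OF rG gh(1,2)] by blast
  then show ?thesis
    by cases (simp_all add: gh ellis_map_apply le)
qed

lemma ellis_set_chain:
  assumes rG: "linear_order_on (carrier G) rG"
    and orbit: "\<And>x. x \<in> K \<Longrightarrow> linear_order_preserving (carrier G) rG r (\<lambda>g. \<phi> g x)"
    and "p \<in> ellis_set" and "q \<in> ellis_set"
  shows "(\<forall>x \<in> K. (p x, q x) \<in> r) \<or> (\<forall>x \<in> K. (q x, p x) \<in> r)"
proof (rule pointwise_chain_closure[OF linear_order, where A = "ellis_map ` carrier G"])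
  show "ellis_map ` carrier G \<subseteq> (\<Pi>\<^sub>E x \<in> K. K)"
    by (rule image_subsetI) (rule ellis_map_in_PiE)
  show "(\<forall>x \<in> K. (p x, q x) \<in> r) \<or> (\<forall>x \<in> K. (q x, p x) \<in> r)"
    if "p \<in> ellis_map ` carrier G" "q \<in> ellis_map ` carrier G" for p q
    using ellis_maps_chain[OF rG orbit that] .
qed (use assms(3,4) in \<open>simp_all only: carrier_ellis_semigroup\<close>)

text \<open>The chain property makes the pointwise order linear, and compactness identifies its
  interval topology with the pointwise topology.\<close>

lemma linearly_ordered_ellis_semigroup:
  assumes rG: "linear_order_on (carrier G) rG"
    and orbit: "\<And>x. x \<in> K \<Longrightarrow> linear_order_preserving (carrier G) rG r (\<lambda>g. \<phi> g x)"
  shows "linearly_ordered_compact_right_topological_semigroup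
    (ellis_semigroup G (interval_topology K r) \<phi>) (ellis_topology G (interval_topology K r) \<phi>)
    ellis_order"
proof -
  interpret S: compact_right_topological_semigroup
    "ellis_semigroup G (interval_topology K r) \<phi>" "ellis_topology G (interval_topology K r) \<phi>"
    by (rule compact_right_topological_ellis_semigroup)
  note chain = ellis_set_chain[OF rG orbit]
  show ?thesis
  proof
    show "linear_order_on ellis_set ellis_order"
      using linear_order ellis_set_subset chain by (rule linear_order_on_pointwise_order)
    \<comment> \<open>Left invariance is monotonicity of the elements of E(K); right invariance
      evaluates a pointwise inequality at the points \<open>s x\<close>.\<close>
    show "bi_invariant (ellis_semigroup G (interval_topology K r) \<phi>) ellis_order"
      unfolding bi_invariant_def mult_ellis_semigroup
      by (auto simp: pointwise_order_def compose_in_ellis_set compose_eq ellis_set_mono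
          ellis_set_closed)
    show "ellis_topology G (interval_topology K r) \<phi> = interval_topology ellis_set ellis_order"
      unfolding ellis_topology_eq
      using linear_order ellis_set_subset chain
        compact_space_ellis_topology[unfolded ellis_topology_eq]
      by (rule pointwise_topology_eq_interval_topology)
  qed
qed

section \<open>Bi-invariance of the order on the group\<close>

text \<open>If \<open>g\<close> and \<open>h\<close> act alike, then
  \<open>inv h \<otimes> g\<close> acts as the identity, so effectiveness makes it the unit.\<close>

lemma effective_translations_eq:
  assumes eff: "effective_action G K \<phi>" and g: "g \<in> carrier G" and h: "h \<in> carrier G"
    and eq: "\<And>x. x \<in> K \<Longrightarrow> \<phi> g x = \<phi> h x"
  shows "g = h"
proof -
  have "\<phi> (inv h \<otimes> g) x = x" if x: "x \<in> K" for x
  proof -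
    have "\<phi> (inv h \<otimes> g) x = \<phi> (inv h) (\<phi> h x)"
      using composition_rule[OF x, of "inv h" g] g h eq[OF x] by simp
    also have "\<dots> = \<phi> (inv h \<otimes> h) x"
      using composition_rule[OF x, of "inv h" h] h by simp
    also have "\<dots> = x" using h x fun_cong[OF id_eq_one, of x] by simp
    finally show ?thesis .
  qed
  then have "inv h \<otimes> g = \<one>" using eff g h by (simp add: effective_action_def)
  then show ?thesis using g h by (metis inv_inv inv_equality inv_closed)
qed

text \<open>Effectiveness makes the order of \<open>G\<close> coincide with the pointwise order of
  translations, and bi-invariance is then read off on \<open>K\<close>.\<close>

lemma bi_invariant_of_orbits:
  assumes eff: "effective_action G K \<phi>" and rG: "linear_order_on (carrier G) rG"
    and orbit: "\<And>x. x \<in> K \<Longrightarrow> linear_order_preserving (carrier G) rG r (\<lambda>g. \<phi> g x)"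
  shows "bi_invariant G rG"
proof -
  \<comment> \<open>Converse of orbit monotonicity: if \<open>h\<close> were strictly below
    \<open>g\<close>, the inequalities in both directions would make \<open>g\<close> and
    \<open>h\<close> act alike, hence be equal.\<close>
  have reflect: "(g, h) \<in> rG"
    if gh: "g \<in> carrier G" "h \<in> carrier G" "\<And>x. x \<in> K \<Longrightarrow> (\<phi> g x, \<phi> h x) \<in> r" for g h
  proof (rule ccontr)
    assume not: "(g, h) \<notin> rG"
    then have "(h, g) \<in> rG" using linear_order_on_total[OF rG] gh by blast
    then have "\<phi> g x = \<phi> h x" if "x \<in> K" for x
      using that gh monotone_onD[OF orbit] linear_order_on_antisym[OF linear_order] by blast
    then have "g = h" using effective_translations_eq[OF eff] gh by blast
    with not gh show False using linear_order_on_refl[OF rG] by blast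
  qed
  show ?thesis
    unfolding bi_invariant_def
  proof (intro ballI impI conjI)
    fix k g h assume k: "k \<in> carrier G" and g: "g \<in> carrier G" and h: "h \<in> carrier G"
      and gh: "(g, h) \<in> rG"
    have le: "(\<phi> g x, \<phi> h x) \<in> r" if "x \<in> K" for x
      using monotone_onD[OF orbit[OF that] g h gh] .
    show "(k \<otimes> g, k \<otimes> h) \<in> rG"
      \<comment> \<open>On the left, the translation by \<open>k\<close> preserves the inequality at
        \<open>x\<close>.\<close>
      using k g h le monotone_onD[OF translation_preserving[OF k]]
      by (intro reflect) (simp_all add: composition_rule translation_closed)
    show "(g \<otimes> k, h \<otimes> k) \<in> rG"
      \<comment> \<open>On the right, the inequality is used at the point
        \<open>\<phi> k x\<close>.\<close>
      using k g h le by (intro reflect) (simp_all add: composition_rule translation_closed)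
  qed
qed

lemma linearly_ordered_compactification_ellis_map:
  assumes eff: "effective_action G K \<phi>" and rG: "linear_order_on (carrier G) rG"
    and orbit: "\<And>x. x \<in> K \<Longrightarrow> linear_order_preserving (carrier G) rG r (\<lambda>g. \<phi> g x)"
  shows "linearly_ordered_semigroup_compactification G TG rG
    (ellis_semigroup G (interval_topology K r) \<phi>) (ellis_topology G (interval_topology K r) \<phi>)
    ellis_order ellis_map"
proof (intro linearly_ordered_semigroup_compactification.intro
    linearly_ordered_semigroup_compactification_axioms.intro)
  show "linear_order_preserving (carrier G) rG ellis_order ellis_map"
    using monotone_onD[OF orbit] ellis_map_in_ellis_set
    by (auto intro!: monotone_onI simp: pointwise_order_def ellis_map_apply)
qed (use rG bi_invariant_of_orbits[OF eff rG orbit] linearly_ordered_ellis_semigroup[OF rG orbit]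
    right_topological_semigroup_compactification_ellis_map in auto)

end

theorem theoremB:
  fixes G :: "('g, 'm) monoid_scheme" and TG :: "'g topology"
    and K :: "'k set" and rK :: "'k rel" and \<phi> :: "'g \<Rightarrow> 'k \<Rightarrow> 'k" and rG :: "'g rel"
  assumes "topological_group G TG"
    and "linearly_ordered_compact_system G TG K rK \<phi>"
    and "effective_action G K \<phi>"
    and "linear_order_on (carrier G) rG"
    and "\<And>x. x \<in> K \<Longrightarrow> linear_order_preserving (carrier G) rG rK (\<lambda>g. \<phi> g x)"
  defines "E \<equiv> ellis_semigroup G (interval_topology K rK) \<phi>"
    and "TE \<equiv> ellis_topology G (interval_topology K rK) \<phi>"
    and "j \<equiv> ellis_compactification (interval_topology K rK) \<phi>"
  shows "\<exists>rE. linearly_ordered_compact_right_topological_semigroup E TE rE \<and>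
    linearly_ordered_semigroup_compactification G TG rG E TE rE j"
proof -
  interpret linearly_ordered_compact_system G TG K rK \<phi> by fact
  show ?thesis
    unfolding E_def TE_def j_def
    \<comment> \<open>The pointwise order \<open>ellis_order\<close> is the common witness for both
      conjuncts.\<close>
    using linearly_ordered_ellis_semigroup[OF assms(4,5)]
      linearly_ordered_compactification_ellis_map[OF assms(3-5)] by blast
qed

end
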